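(* Let $S=\{0,1\}^\ell$ with $\ell\ge1$ be the secret space. The revised generation-based scheme $\Pi'$ described in the context is an evolving $3$-threshold secret sharing scheme with perfect correctness and perfect secrecy. That is, for every $s\in S$, the shares of any set of at least three participants determine $s$ with probability $1$; and for any set $C$ of at most two participants, the joint distribution of the shares of the participants in $C$ is the same for all secrets $s\in S$.
   Context: Participants $P_1,P_2,\dots$ arrive one by one, and there may be infinitely many of them. Shares are produced one participant at a time without changing earlier shares. A $(3,n)$-threshold scheme is a randomized map sending a secret $s\in S$ to $n$ shares such that any $3$ shares determine $s$ (correctness), while the joint distribution of any at most $2$ shares does not depend on $s$ (secrecy). An evolving $3$-threshold scheme is the analogue with an infinite sequence of shares: any $3$ determine $s$, and the joint distribution of any at most $2$ does not depend on $s$. Generations: let $n_0=0$ and $n_i=2^{4^i}$ for $i\ge 1$. Generation $G^i$ consists of $P_{n_{i-1}+1},\dots,P_{n_i}$ and has size $S(G^i)=n_i-n_{i-1}$. For a participant $P_t$, let $g(t)$ be the index of its generation, and let $h(t)=t-n_{g(t)-1}\in\{1,\dots,S(G^{g(t)})\}$ be its position in that generation. Ingredients of $\Pi'$, all generated with independent randomness for the same secret $s$: - an evolving $3$-threshold scheme $\mathcal S^\infty$ (correct and secret) with shares $sh^\infty_1,sh^\infty_2,\dots$, one for each generation; - for each $i\ge1$, a $(3,S(G^i)+1)$-threshold scheme $\mathcal S^i$ (correct and secret) with shares $sh^i_1,\dots,sh^i_{S(G^i)},sh^i_F$, where the shares $sh^i_F$ for all $i$ are written as bit strings of one common length; - for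 each $i\ge1$, a uniformly random bit string $SR^i$ of that common length. In $\Pi'$, participant $P_t$, with $g=g(t)$, receives the following pieces: (P1) $sh^\infty_{g}$; (P2) the forward shares $sh^1_F,\dots,sh^{g-1}_F$; (P3) $sh^{g}_{h(t)}$; (P4) the masked shares $SR^{j}\oplus sh^{g}_F$ for $1\le j\le g-1$; (P5) the string $SR^{g}$. *)

theory Defs
  imports "HOL-Probability.Probability"
begin

text \<open>
  A secret sharing scheme with participant set \<open>I\<close> is given by the distribution of the whole
  family of shares, for each secret. Individual shares live in discrete (countable) spaces; for
  infinite \<open>I\<close> the family carries the product sigma-algebra. Since there is one family of shares
  for all participants, a share never changes when later participants arrive.
\<close>

definition share_space :: "nat set \<Rightarrow> (nat \<Rightarrow> 'a) measure" where
  "share_space I = PiM I (\<lambda>_. count_space UNIV)"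

definition sharing_scheme :: "nat set \<Rightarrow> 's set \<Rightarrow> ('s \<Rightarrow> (nat \<Rightarrow> 'a::countable) measure) \<Rightarrow> bool" where
  "sharing_scheme I S D \<longleftrightarrow>
     (\<forall>s\<in>S. prob_space (D s) \<and> sets (D s) = sets (share_space I))"

text \<open>The set \<open>C\<close> of participants may be infinite; the reconstruction function may depend on \<open>C\<close>
  but not on the secret.\<close>

definition perfectly_correct ::
    "nat \<Rightarrow> nat set \<Rightarrow> 's set \<Rightarrow> ('s \<Rightarrow> (nat \<Rightarrow> 'a::countable) measure) \<Rightarrow> bool" where
  "perfectly_correct k I S D \<longleftrightarrow>
     (\<forall>C\<subseteq>I. infinite C \<or> k \<le> card C \<longrightarrow>
        (\<exists>rec :: (nat \<Rightarrow> 'a) \<Rightarrow> 's. \<forall>s\<in>S. AE x in D s. rec (restrict x C) = s))"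

definition perfectly_secret ::
    "nat \<Rightarrow> nat set \<Rightarrow> 's set \<Rightarrow> ('s \<Rightarrow> (nat \<Rightarrow> 'a::countable) measure) \<Rightarrow> bool" where
  "perfectly_secret k I S D \<longleftrightarrow>
     (\<forall>C\<subseteq>I. finite C \<and> card C < k \<longrightarrow>
        (\<forall>s\<in>S. \<forall>s'\<in>S.
           distr (D s) (share_space C) (\<lambda>x. restrict x C) =
           distr (D s') (share_space C) (\<lambda>x. restrict x C)))"

definition threshold_scheme ::
    "nat \<Rightarrow> nat \<Rightarrow> 's set \<Rightarrow> ('s \<Rightarrow> (nat \<Rightarrow> 'a::countable) measure) \<Rightarrow> bool" where
  "threshold_scheme k n S D \<longleftrightarrow>
     sharing_scheme {1..n} S D \<and> perfectly_correct k {1..n} S D \<and> perfectly_secret k {1..n} S D"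

definition evolving_threshold_scheme ::
    "nat \<Rightarrow> 's set \<Rightarrow> ('s \<Rightarrow> (nat \<Rightarrow> 'a::countable) measure) \<Rightarrow> bool" where
  "evolving_threshold_scheme k S D \<longleftrightarrow>
     sharing_scheme {1..} S D \<and> perfectly_correct k {1..} S D \<and> perfectly_secret k {1..} S D"

definition bitstrings :: "nat \<Rightarrow> bool list set" where
  "bitstrings l = {xs. length xs = l}"

definition xor_bits :: "bool list \<Rightarrow> bool list \<Rightarrow> bool list" where
  "xor_bits xs ys = map2 (\<noteq>) xs ys"

definition gen_end :: "nat \<Rightarrow> nat" where
  "gen_end i = (if i = 0 then 0 else 2 ^ (4 ^ i))"

definition generation :: "nat \<Rightarrow> nat set" where
  "generation i = {gen_end (i - 1)<..gen_end i}"

definition gen_size :: "nat \<Rightarrow> nat" where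
  "gen_size i = gen_end i - gen_end (i - 1)"

definition gen_of :: "nat \<Rightarrow> nat" where
  "gen_of t = (THE i. 1 \<le> i \<and> t \<in> generation i)"

definition gen_pos :: "nat \<Rightarrow> nat" where
  "gen_pos t = t - gen_end (gen_of t - 1)"

text \<open>The forward share \<open>sh\<^sup>i\<^sub>F\<close> is the last of the \<open>gen_size i + 1\<close> shares of the \<open>i\<close>-th scheme.\<close>

definition fwd :: "nat \<Rightarrow> nat" where
  "fwd i = gen_size i + 1"

text \<open>
  The share of participant \<open>t\<close> of generation \<open>g\<close>, computed from the shares \<open>x\<close> of the evolving
  scheme, the shares \<open>y i\<close> of the \<open>i\<close>-th threshold scheme and the masks \<open>r i\<close>. It consists of the
  evolving share of the generation, the forward shares of all earlier generations, the
  participant's own share of the \<open>g\<close>-th threshold scheme, the forward share of generation \<open>g\<close>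
  masked with the mask of each earlier generation, and the mask of generation \<open>g\<close>. The two lists
  are indexed by \<open>1 \<le> j \<le> g - 1\<close>.
\<close>

definition revised_share ::
    "(nat \<Rightarrow> 'a) \<Rightarrow> (nat \<Rightarrow> nat \<Rightarrow> bool list) \<Rightarrow> (nat \<Rightarrow> bool list) \<Rightarrow> nat \<Rightarrow>
     'a \<times> bool list list \<times> bool list \<times> bool list list \<times> bool list" where
  "revised_share x y r t =
     (let g = gen_of t in
       (x g,
        map (\<lambda>j. y j (fwd j)) [1..<g],
        y g (gen_pos t),
        map (\<lambda>j. xor_bits (r j) (y g (fwd g))) [1..<g],
        r g))"

text \<open>Independence of all ingredients, given the secret, is expressed by product measures.\<close>

definition revised_scheme ::
    "nat \<Rightarrow> ('s \<Rightarrow> (nat \<Rightarrow> 'a::countable) measure) \<Rightarrow> (nat \<Rightarrow> 's \<Rightarrow> (nat \<Rightarrow> bool list) measure) \<Rightarrow>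
     's \<Rightarrow> (nat \<Rightarrow> 'a \<times> bool list list \<times> bool list \<times> bool list list \<times> bool list) measure" where
  "revised_scheme L Dinf D s =
     distr
       (Dinf s \<Otimes>\<^sub>M PiM {1..} (\<lambda>i. D i s) \<Otimes>\<^sub>M
        PiM {1..} (\<lambda>_. measure_pmf (pmf_of_set (bitstrings L))))
       (share_space {1..})
       (\<lambda>(x, y, r). \<lambda>t\<in>{1..}. revised_share x y r t)"

end

theory Submission
  imports Defs
begin

text \<open>
  Correctness: three participants from distinct generations use the evolving scheme. If two of them
  share a generation \<open>g\<close>, the third one supplies a third share of the \<open>g\<close>-th threshold scheme: its own
  share (same generation), the forward share (later generation), or the mask that uncovers the
  forward share held in masked form by the other two (earlier generation).

  Secrecy: two participants of distinct generations see a function of the masks and of at most two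
  shares of each ingredient scheme. Two participants of the same generation \<open>g\<close> see two shares of the
  \<open>g\<close>-th threshold scheme and, in addition, its forward share masked with the masks of the earlier
  generations, which they do not hold. Adding the forward share to these masks preserves the joint
  distribution (one-time pad), and after this change of variables the view no longer depends on the
  forward share.
\<close>

section \<open>Push-forwards of product measures\<close>

text \<open>A finite measure on a possibly infinite product is determined by its values on cylinders
  over finitely many coordinates. The preimage of such a cylinder under a componentwise map is a
  cylinder over the same coordinates, and both sides give it the same finite product.\<close>

lemma distr_PiM_componentwise:
  assumes M: "\<And>i. i \<in> I \<Longrightarrow> prob_space (M i)"
    and f [measurable]: "\<And>i. i \<in> I \<Longrightarrow> f i \<in> measurable (M i) (N i)"
  shows "distr (PiM I M) (PiM I N) (\<lambda>x. \<lambda>i\<in>I. f i (x i)) = PiM I (\<lambda>i. distr (M i) (N i) (f i))"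
    (is "distr _ _ ?t = ?P")
proof (rule measure_eqI_PiM_infinite[symmetric, OF refl])
  have P: "prob_space (distr (M i) (N i) (f i))" if "i \<in> I" for i
    using that M f by (intro prob_space.prob_space_distr) auto
  interpret prob_space ?P
    by (intro prob_space_PiM P)
  show "finite_measure ?P"
    by unfold_locales
  show "sets (distr (PiM I M) (PiM I N) ?t) = sets ?P"
    by (simp cong: sets_PiM_cong)
  fix A J assume J: "finite J" "J \<subseteq> I" and A: "\<And>i. i \<in> J \<Longrightarrow> A i \<in> sets (distr (M i) (N i) (f i))"
  let ?N = "\<lambda>i. distr (M i) (N i) (f i)"
  have [measurable]: "?t \<in> measurable (PiM I M) (PiM I N)"
    by measurable
  have emb: "?t -` prod_emb I ?N J (Pi\<^sub>E J A) \<inter> space (PiM I M)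
      = prod_emb I M J (Pi\<^sub>E J (\<lambda>i. f i -` A i \<inter> space (M i)))"
  proof (rule set_eqI)
    fix x
    have "x \<in> space (PiM I M) \<Longrightarrow> f i (x i) \<in> space (N i)" if "i \<in> I" for i
      using that f[THEN measurable_space] by (auto simp: space_PiM)
    moreover have "x \<in> space (PiM I M) \<Longrightarrow> x i \<in> space (M i)" if "i \<in> I" for i
      using that by (auto simp: space_PiM)
    ultimately show "x \<in> ?t -` prod_emb I ?N J (Pi\<^sub>E J A) \<inter> space (PiM I M) \<longleftrightarrow>
        x \<in> prod_emb I M J (Pi\<^sub>E J (\<lambda>i. f i -` A i \<inter> space (M i)))"
      using J(2) by (auto simp: prod_emb_iff space_PiM PiE_iff subset_eq)
  qed
  have "prod_emb I ?N J (Pi\<^sub>E J A) \<in> sets (PiM I ?N)"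
    using J A by (intro sets_PiM_I) auto
  then have "emeasure (distr (PiM I M) (PiM I N) ?t) (prod_emb I ?N J (Pi\<^sub>E J A))
      = emeasure (PiM I M) (prod_emb I M J (Pi\<^sub>E J (\<lambda>i. f i -` A i \<inter> space (M i))))"
    by (subst emeasure_distr) (auto simp: emb cong: sets_PiM_cong)
  also have "\<dots> = (\<Prod>i\<in>J. emeasure (M i) (f i -` A i \<inter> space (M i)))"
    using J A by (intro emeasure_PiM_emb M measurable_sets[OF f]) auto
  also have "\<dots> = (\<Prod>i\<in>J. emeasure (?N i) (A i))"
    using J A f by (intro prod.cong refl emeasure_distr[symmetric]) auto
  also have "\<dots> = emeasure ?P (prod_emb I ?N J (Pi\<^sub>E J A))"
    using J A P by (intro emeasure_PiM_emb[symmetric]) auto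
  finally show "emeasure ?P (prod_emb I ?N J (Pi\<^sub>E J A))
      = emeasure (distr (PiM I M) (PiM I N) ?t) (prod_emb I ?N J (Pi\<^sub>E J A))" ..
qed

text \<open>By Fubini, a set is measured by integrating the measures of its sections, and almost
  every fibre map preserves those. An almost sure condition is what is available later: forward
  shares have length \<open>L\<close> only with probability 1.\<close>

lemma distr_pair_fibrewise:
  assumes "prob_space N"
    and f [measurable]: "(\<lambda>(x, y). f x y) \<in> measurable (M \<Otimes>\<^sub>M N) N"
    and inv: "AE x in M. distr N N (f x) = N"
  shows "distr (M \<Otimes>\<^sub>M N) (M \<Otimes>\<^sub>M N) (\<lambda>(x, y). (x, f x y)) = M \<Otimes>\<^sub>M N"
proof (rule measure_eqI)
  interpret N: prob_space N by fact
  fix A assume "A \<in> sets (distr (M \<Otimes>\<^sub>M N) (M \<Otimes>\<^sub>M N) (\<lambda>(x, y). (x, f x y)))"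
  then have A [measurable]: "A \<in> sets (M \<Otimes>\<^sub>M N)"
    by simp
  let ?T = "\<lambda>(x, y). (x, f x y)"
  have T [measurable]: "?T \<in> measurable (M \<Otimes>\<^sub>M N) (M \<Otimes>\<^sub>M N)"
    using f by (simp add: split_beta')
  have "emeasure (distr (M \<Otimes>\<^sub>M N) (M \<Otimes>\<^sub>M N) ?T) A = emeasure (M \<Otimes>\<^sub>M N) (?T -` A \<inter> space (M \<Otimes>\<^sub>M N))"
    by (rule emeasure_distr) measurable
  also have "\<dots> = (\<integral>\<^sup>+x. emeasure N (Pair x -` (?T -` A \<inter> space (M \<Otimes>\<^sub>M N))) \<partial>M)"
    by (intro N.emeasure_pair_measure_alt) measurable
  also have "\<dots> = (\<integral>\<^sup>+x. emeasure N (Pair x -` A) \<partial>M)"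
  proof (rule nn_integral_cong_AE)
    show "AE x in M. emeasure N (Pair x -` (?T -` A \<inter> space (M \<Otimes>\<^sub>M N))) = emeasure N (Pair x -` A)"
      using inv AE_space
    proof eventually_elim
      fix x assume x: "distr N N (f x) = N" "x \<in> space M"
      have fx: "f x \<in> measurable N N"
        using measurable_compose[OF measurable_Pair1'[OF x(2)] f] by (simp only: prod.case)
      have "Pair x -` (?T -` A \<inter> space (M \<Otimes>\<^sub>M N)) = f x -` (Pair x -` A) \<inter> space N"
        using x(2) by (simp add: space_pair_measure set_eq_iff)
      then have "emeasure N (Pair x -` (?T -` A \<inter> space (M \<Otimes>\<^sub>M N))) = emeasure (distr N N (f x)) (Pair x -` A)"
        by (simp only: emeasure_distr[OF fx sets_Pair1[OF A]])
      with x(1) show "emeasure N (Pair x -` (?T -` A \<inter> space (M \<Otimes>\<^sub>M N))) = emeasure N (Pair x -` A)"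
        by (simp only:)
    qed
  qed
  also have "\<dots> = emeasure (M \<Otimes>\<^sub>M N) A"
    by (rule N.emeasure_pair_measure_alt[symmetric]) measurable
  finally show "emeasure (distr (M \<Otimes>\<^sub>M N) (M \<Otimes>\<^sub>M N) ?T) A = emeasure (M \<Otimes>\<^sub>M N) A" .
qed simp

section \<open>Measurability of shares\<close>

text \<open>Holds also for \<open>i \<notin> A\<close>, where the elements of \<open>share_space A\<close> are constantly \<open>undefined\<close>.\<close>

lemma measurable_share_eval:
  "(\<lambda>x::nat \<Rightarrow> 'a. x i) \<in> measurable (share_space A) (count_space UNIV)"
proof (cases "i \<in> A")
  case False
  then have "(\<lambda>x::nat \<Rightarrow> 'a. x i) \<in> measurable (share_space A) (count_space UNIV) \<longleftrightarrow>
      (\<lambda>_. undefined :: 'a) \<in> measurable (share_space A) (count_space UNIV)"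
    using measurable_cong[of "share_space A" "\<lambda>x::nat \<Rightarrow> 'a. x i" "\<lambda>_. undefined" "count_space UNIV"]
    by (simp add: share_space_def space_PiM PiE_def extensional_def)
  then show ?thesis by simp
qed (auto simp: share_space_def)

text \<open>For countable types the product sigma-algebra of two discrete spaces is again
  discrete.\<close>

lemma measurable_count_space_Pair:
  fixes f :: "'m \<Rightarrow> 'b::countable" and g :: "'m \<Rightarrow> 'c::countable"
  assumes "f \<in> measurable M (count_space UNIV)" "g \<in> measurable M (count_space UNIV)"
  shows "(\<lambda>x. (f x, g x)) \<in> measurable M (count_space UNIV)"
  using measurable_Pair[OF assms] by (simp add: pair_measure_countable)

lemma measurable_count_space_map:
  fixes f :: "'i \<Rightarrow> 'm \<Rightarrow> 'b::countable"
  assumes "\<And>i. i \<in> set xs \<Longrightarrow> f i \<in> measurable M (count_space UNIV)"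
  shows "(\<lambda>x. map (\<lambda>i. f i x) xs) \<in> measurable M (count_space UNIV)"
  using assms
proof (induction xs)
  case (Cons i xs)
  then have "(\<lambda>x. (f i x, map (\<lambda>i. f i x) xs)) \<in> measurable M (count_space UNIV)"
    by (intro measurable_count_space_Pair) auto
  then have "(\<lambda>x. (\<lambda>(a, as). a # as) (f i x, map (\<lambda>i. f i x) xs)) \<in> measurable M (count_space UNIV)"
    by (rule measurable_compose) simp
  then show ?case by simp
qed simp

lemma measurable_revised_share:
  fixes x :: "'m \<Rightarrow> nat \<Rightarrow> 'a::countable"
  assumes x: "\<And>i. (\<lambda>\<omega>. x \<omega> i) \<in> measurable M (count_space UNIV)"
    and y: "\<And>i j. i \<ge> 1 \<Longrightarrow> (\<lambda>\<omega>. y \<omega> i j) \<in> measurable M (count_space UNIV)"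
    and r: "\<And>i. i \<ge> 1 \<Longrightarrow> (\<lambda>\<omega>. r \<omega> i) \<in> measurable M (count_space UNIV)"
    and t: "gen_of t \<ge> 1"
  shows "(\<lambda>\<omega>. revised_share (x \<omega>) (y \<omega>) (r \<omega>) t) \<in> measurable M (count_space UNIV)"
proof -
  have "(\<lambda>\<omega>. xor_bits (r \<omega> i) (y \<omega> j k)) \<in> measurable M (count_space UNIV)"
    if "i \<ge> 1" "j \<ge> 1" for i j k
    using measurable_compose[OF measurable_count_space_Pair[OF r[OF that(1)] y[OF that(2)]],
      of "\<lambda>(a, b). xor_bits a b" "count_space UNIV"] by simp
  then show ?thesis
    unfolding revised_share_def Let_def using t
    by (intro measurable_count_space_Pair measurable_count_space_map x y r) auto
qed

section \<open>Generations and positions\<close>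

lemma gen_end_strict_mono: "strict_mono gen_end"
  unfolding strict_mono_Suc_iff gen_end_def by auto

lemma generation_unique:
  assumes "t \<in> generation i" "t \<in> generation j" "i \<ge> 1" "j \<ge> 1"
  shows "i = j"
proof (rule ccontr)
  have *: False if "t \<in> generation i" "t \<in> generation j" "i < j" for i j
  proof -
    have "gen_end i \<le> gen_end (j - 1)"
      using that(3) by (intro strict_mono_leD[OF gen_end_strict_mono]) auto
    with that show False by (auto simp: generation_def)
  qed
  assume "i \<noteq> j"
  with * assms show False by (meson linorder_neqE_nat)
qed

text \<open>This justifies the definite description in \<open>gen_of\<close>: existence follows from
  the unboundedness of \<open>gen_end\<close>, uniqueness from the disjointness of
  generations.\<close>

lemma gen_of_spec:
  assumes "t \<ge> 1"
  shows "gen_of t \<ge> 1 \<and> t \<in> generation (gen_of t)"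
proof -
  have le: "t \<le> gen_end t"
    using strict_mono_imp_increasing[OF gen_end_strict_mono] by simp
  \<comment> \<open>The generation of \<open>t\<close> is the first one whose end reaches
    \<open>t\<close>; by minimality the previous end lies strictly below \<open>t\<close>.\<close>
  define i where "i = (LEAST i. t \<le> gen_end i)"
  have i: "t \<le> gen_end i"
    unfolding i_def using le by (rule LeastI)
  then have i1: "i \<ge> 1"
    using assms by (cases i) (auto simp: gen_end_def)
  have "\<not> t \<le> gen_end (i - 1)"
    using i1 not_less_Least[of "i - 1" "\<lambda>i. t \<le> gen_end i"] by (auto simp: i_def[symmetric])
  with i have "t \<in> generation i"
    by (simp add: generation_def)
  with i1 show ?thesis
    unfolding gen_of_def using generation_unique
    by (intro theI[of "\<lambda>i. 1 \<le> i \<and> t \<in> generation i"]) auto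
qed

lemma gen_pos_bounds:
  assumes "t \<ge> 1"
  shows "gen_pos t \<in> {1..gen_size (gen_of t)}"
  using gen_of_spec[OF assms] by (auto simp: gen_pos_def gen_size_def generation_def)

text \<open>Since \<open>t\<close> exceeds the end of the previous generation, the subtraction in
  \<open>gen_pos\<close> is not truncated and can be undone.\<close>

lemma gen_pos_inj:
  assumes "t \<ge> 1" "u \<ge> 1" "gen_of t = gen_of u" "gen_pos t = gen_pos u"
  shows "t = u"
  using gen_of_spec[OF assms(1)] gen_of_spec[OF assms(2)] assms(3,4)
  by (simp only: gen_pos_def generation_def greaterThanAtMost_iff) linarith

section \<open>Views as functions of the coins\<close>

text \<open>In order: the shares of the evolving scheme, the shares of the threshold schemes by
  generation, and the masks.\<close>

type_synonym 'a coins = "(nat \<Rightarrow> 'a) \<times> (nat \<Rightarrow> nat \<Rightarrow> bool list) \<times> (nat \<Rightarrow> bool list)"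

type_synonym 'a piece = "'a \<times> bool list list \<times> bool list \<times> bool list list \<times> bool list"

definition view :: "nat set \<Rightarrow> 'a coins \<Rightarrow> nat \<Rightarrow> 'a piece" where
  "view T = (\<lambda>(x, y, r). \<lambda>t\<in>T. revised_share x y r t)"

text \<open>The view of participants of generation \<open>g\<close> after the change of variables \<open>shift_masks g\<close>:
  the masks \<open>r j\<close> of the earlier generations stand in for the masked forward shares.\<close>

definition unmasked_view :: "nat \<Rightarrow> nat set \<Rightarrow> 'a coins \<Rightarrow> nat \<Rightarrow> 'a piece" where
  "unmasked_view g T = (\<lambda>(x, y, r). \<lambda>t\<in>T.
     (x g, map (\<lambda>j. y j (fwd j)) [1..<g], y g (gen_pos t), map r [1..<g], r g))"

text \<open>The one-time pad as a change of variables. Masks from index \<open>g\<close> on stay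
  fixed: generation \<open>g\<close> holds \<open>r g\<close> in the clear and pads its forward
  share with earlier masks only.\<close>

definition shift_masks :: "nat \<Rightarrow> (nat \<Rightarrow> nat \<Rightarrow> bool list) \<Rightarrow> (nat \<Rightarrow> bool list) \<Rightarrow> nat \<Rightarrow> bool list" where
  "shift_masks g y r = (\<lambda>i\<in>{1..}. if i < g then xor_bits (r i) (y g (fwd g)) else r i)"

abbreviation "masks L \<equiv> PiM {1::nat..} (\<lambda>_. measure_pmf (pmf_of_set (bitstrings L)))"

text \<open>The index sets are parameters so that the same measurability facts serve the full share
  families and the restricted ones of \<open>marginals\<close>.\<close>

abbreviation ingredient_space :: "nat set \<Rightarrow> (nat \<Rightarrow> nat set) \<Rightarrow> 'a coins measure" where
  "ingredient_space A B \<equiv>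
  share_space A \<Otimes>\<^sub>M PiM {1::nat..} (\<lambda>i. share_space (B i)) \<Otimes>\<^sub>M PiM {1::nat..} (\<lambda>_. count_space UNIV)"

lemma measurable_ingredients:
  "(\<lambda>\<omega>. fst \<omega> i) \<in> measurable (ingredient_space A B) (count_space UNIV)"
  "k \<ge> 1 \<Longrightarrow> (\<lambda>\<omega>. fst (snd \<omega>) k i) \<in> measurable (ingredient_space A B) (count_space UNIV)"
  "k \<ge> 1 \<Longrightarrow> (\<lambda>\<omega>. snd (snd \<omega>) k) \<in> measurable (ingredient_space A B) (count_space UNIV)"
proof -
  show "(\<lambda>\<omega>. fst \<omega> i) \<in> measurable (ingredient_space A B) (count_space UNIV)"
    by (rule measurable_compose[OF measurable_fst measurable_share_eval])
  assume k: "k \<ge> 1"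
  have "(\<lambda>\<omega>. fst (snd \<omega>) k) \<in> measurable (ingredient_space A B) (share_space (B k))"
    using k by (intro measurable_compose[OF measurable_snd]
      measurable_compose[OF measurable_fst] measurable_component_singleton) auto
  then show "(\<lambda>\<omega>. fst (snd \<omega>) k i) \<in> measurable (ingredient_space A B) (count_space UNIV)"
    by (rule measurable_compose[OF _ measurable_share_eval])
  show "(\<lambda>\<omega>. snd (snd \<omega>) k) \<in> measurable (ingredient_space A B) (count_space UNIV)"
    using k by (intro measurable_compose[OF measurable_snd]
      measurable_compose[OF measurable_snd] measurable_component_singleton) auto
qed

lemma measurable_view:
  assumes "T \<subseteq> {1..}"
  shows "view T \<in> measurable (ingredient_space A B)
    (share_space T :: (nat \<Rightarrow> 'a::countable piece) measure)"
  unfolding view_def share_space_def[of T] split_beta'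
proof (rule measurable_restrict)
  fix t assume "t \<in> T"
  with assms have "gen_of t \<ge> 1"
    using gen_of_spec by auto
  then show "(\<lambda>\<omega> :: 'a coins. revised_share (fst \<omega>) (fst (snd \<omega>)) (snd (snd \<omega>)) t)
      \<in> measurable (ingredient_space A B) (count_space UNIV)"
    by (intro measurable_revised_share measurable_ingredients) auto
qed

lemma measurable_unmasked_view:
  assumes "g \<ge> 1"
  shows "unmasked_view g T \<in> measurable (ingredient_space A B)
    (share_space T :: (nat \<Rightarrow> 'a::countable piece) measure)"
  unfolding unmasked_view_def share_space_def[of T] split_beta'
proof (rule measurable_restrict)
  fix t
  have masks: "(\<lambda>\<omega> :: 'a coins. map (snd (snd \<omega>)) [1..<g]) \<in> measurable (ingredient_space A B) (count_space UNIV)"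
    by (rule measurable_count_space_map, rule measurable_ingredients) simp
  show "(\<lambda>\<omega> :: 'a coins. (fst \<omega> g, map (\<lambda>j. fst (snd \<omega>) j (fwd j)) [1..<g], fst (snd \<omega>) g (gen_pos t),
      map (snd (snd \<omega>)) [1..<g], snd (snd \<omega>) g))
      \<in> measurable (ingredient_space A B) (count_space UNIV)"
    by (intro measurable_count_space_Pair measurable_count_space_map measurable_ingredients masks assms) simp
qed

text \<open>For a participant of generation \<open>g\<close>, the masked share at index
  \<open>j\<close> is by definition the value of \<open>shift_masks g y r\<close> at
  \<open>j\<close>.\<close>

lemma view_eq_unmasked_view_shift_masks:
  assumes "\<And>t. t \<in> T \<Longrightarrow> gen_of t = g" "g \<ge> 1"
  shows "view T (x, y, r) = unmasked_view g T (x, y, shift_masks g y r)"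
proof
  show "view T (x, y, r) t = unmasked_view g T (x, y, shift_masks g y r) t" for t
    using assms by (cases "t \<in> T") (simp_all add: view_def unmasked_view_def shift_masks_def revised_share_def)
qed

section \<open>The one-time pad\<close>

text \<open>\<open>map2\<close> truncates to the shorter list, hence the length conditions. The
  first law makes padding an involution; the second recovers a padded message from its mask.\<close>

lemma xor_bits_cancel:
  "length xs = length ys \<Longrightarrow> xor_bits (xor_bits xs ys) ys = xs"
  "length xs = length ys \<Longrightarrow> xor_bits (xor_bits xs ys) xs = ys"
  by (auto simp: xor_bits_def intro!: nth_equalityI)

lemma finite_bitstrings: "finite (bitstrings L)"
  using finite_lists_length_eq[of "UNIV :: bool set" L] by (simp add: bitstrings_def)

lemma bitstrings_nonempty: "bitstrings L \<noteq> {}"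
  by (auto simp: bitstrings_def intro: exI[of _ "replicate L False"])

text \<open>Padding with a fixed string of length \<open>L\<close> is an involution of
  \<open>bitstrings L\<close>, and a bijection preserves the uniform distribution.\<close>

lemma xor_bits_uniform:
  assumes "length m = L"
  shows "distr (measure_pmf (pmf_of_set (bitstrings L))) (measure_pmf (pmf_of_set (bitstrings L))) (\<lambda>v. xor_bits v m)
    = measure_pmf (pmf_of_set (bitstrings L))"
proof -
  have "bij_betw (\<lambda>v. xor_bits v m) (bitstrings L) (bitstrings L)"
    using assms by (intro bij_betwI[where g = "\<lambda>v. xor_bits v m"])
      (auto simp: bitstrings_def xor_bits_cancel, auto simp: xor_bits_def)
  then have "map_pmf (\<lambda>v. xor_bits v m) (pmf_of_set (bitstrings L)) = pmf_of_set (bitstrings L)"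
    by (intro map_pmf_of_set_bij_betw bitstrings_nonempty finite_bitstrings)
  then have "distr (measure_pmf (pmf_of_set (bitstrings L))) (count_space UNIV) (\<lambda>v. xor_bits v m)
      = measure_pmf (pmf_of_set (bitstrings L))"
    by (simp only: map_pmf_rep_eq[symmetric])
  \<comment> \<open>Only the target space changes; a \<open>measure_pmf\<close> carries the discrete
    sigma-algebra.\<close>
  moreover have "distr (measure_pmf (pmf_of_set (bitstrings L))) (measure_pmf (pmf_of_set (bitstrings L))) (\<lambda>v. xor_bits v m)
      = distr (measure_pmf (pmf_of_set (bitstrings L))) (count_space UNIV) (\<lambda>v. xor_bits v m)"
    by (rule distr_cong) simp_all
  ultimately show ?thesis
    by simp
qed

text \<open>For fixed \<open>y\<close> the shift acts on each mask separately, as a pad or as the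
  identity, so it preserves every factor of the product.\<close>

lemma shift_masks_uniform:
  assumes "length (y g (fwd g)) = L"
  shows "distr (masks L) (masks L) (shift_masks g y) = masks L"
proof -
  let ?U = "measure_pmf (pmf_of_set (bitstrings L))"
  let ?f = "\<lambda>i v. if i < g then xor_bits v (y g (fwd g)) else v"
  have "distr (masks L) (masks L) (\<lambda>r. \<lambda>i\<in>{1..}. ?f i (r i)) = PiM {1..} (\<lambda>i. distr ?U ?U (?f i))"
    by (rule distr_PiM_componentwise) (auto simp: prob_space_measure_pmf)
  also have "(\<lambda>i. distr ?U ?U (?f i)) = (\<lambda>_. ?U)"
  proof
    show "distr ?U ?U (?f i) = ?U" for i
      using xor_bits_uniform[OF assms] by (cases "i < g") (simp_all add: distr_id2)
  qed
  finally show ?thesis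
    by (simp only: shift_masks_def[abs_def])
qed

lemma sets_masks: "sets (masks L) = sets (PiM {1..} (\<lambda>_. count_space UNIV))"
  by (intro sets_PiM_cong) auto

section \<open>The joint randomness for one secret\<close>

text \<open>\<open>X\<close> and \<open>Y\<close> are the ingredient distributions for one fixed
  secret, which itself is not mentioned. Secrecy then amounts to comparing two instances of this
  locale.\<close>

locale dealer =
  fixes L :: nat and X :: "(nat \<Rightarrow> 'a::countable) measure" and Y :: "nat \<Rightarrow> (nat \<Rightarrow> bool list) measure"
  assumes prob_space_X: "prob_space X"
    and sets_X: "sets X = sets (share_space {1..})"
    and prob_space_Y: "\<And>i. i \<ge> 1 \<Longrightarrow> prob_space (Y i)"
    and sets_Y: "\<And>i. i \<ge> 1 \<Longrightarrow> sets (Y i) = sets (share_space {1..gen_size i + 1})"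
    and length_fwd: "\<And>i. i \<ge> 1 \<Longrightarrow> AE y in Y i. length (y (fwd i)) = L"
begin

definition randomness where
  "randomness = X \<Otimes>\<^sub>M PiM {1..} Y \<Otimes>\<^sub>M masks L"

lemma prob_space_masks: "prob_space (masks L)"
  by (intro prob_space_PiM) (auto simp: prob_space_measure_pmf)

lemma prob_space_PiM_Y: "prob_space (PiM {1..} Y)"
  by (intro prob_space_PiM) (auto simp: prob_space_Y)

lemma prob_space_Y_masks: "prob_space (PiM {1..} Y \<Otimes>\<^sub>M masks L)"
  by (intro prob_space_pair prob_space_PiM_Y prob_space_masks)

lemma prob_space_randomness: "prob_space randomness"
  unfolding randomness_def by (intro prob_space_pair prob_space_X prob_space_Y_masks)

lemma sets_randomness:
  "sets randomness = sets (ingredient_space {1..} (\<lambda>i. {1..gen_size i + 1}))"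
  unfolding randomness_def
  by (intro sets_pair_measure_cong sets_PiM_cong sets_X sets_Y) auto

lemma measurable_randomness:
  "measurable randomness N = measurable (ingredient_space {1..} (\<lambda>i. {1..gen_size i + 1})) N"
  by (intro measurable_cong_sets sets_randomness refl)

text \<open>Given the threshold shares, the masks are still uniform and independent, so the shift
  preserves their law for almost every \<open>y\<close>; the evolving shares are not
  touched.\<close>

lemma distr_shift_masks:
  assumes g: "g \<ge> 1"
  shows "(\<lambda>(x, y, r). (x, y, shift_masks g y r)) \<in> measurable randomness randomness"
    and "distr randomness randomness (\<lambda>(x, y, r). (x, y, shift_masks g y r)) = randomness"
proof -
  let ?Q = "PiM {1..} Y \<Otimes>\<^sub>M masks L"
  interpret Q: prob_space ?Q by (rule prob_space_Y_masks)
  have len: "AE y in PiM {1..} Y. length (y g (fwd g)) = L"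
    using g by (intro AE_PiM_component[where P = "\<lambda>y. length (y (fwd g)) = L"] length_fwd prob_space_Y) auto
  have Q: "sets ?Q = sets (PiM {1..} (\<lambda>i. share_space {1..gen_size i + 1}) \<Otimes>\<^sub>M PiM {1..} (\<lambda>_. count_space UNIV))"
    by (intro sets_pair_measure_cong sets_PiM_cong sets_Y) auto
  have m: "(\<lambda>(y, r). shift_masks g y r) \<in> measurable ?Q (masks L)"
    unfolding measurable_cong_sets[OF Q sets_masks] shift_masks_def split_beta'
  proof (rule measurable_restrict)
    let ?N = "PiM {1..} (\<lambda>i. share_space {1..gen_size i + 1}) \<Otimes>\<^sub>M PiM {1..} (\<lambda>_. count_space UNIV)"
    fix i :: nat assume i: "i \<in> {1..}"
    have r: "(\<lambda>\<omega>. snd \<omega> i) \<in> measurable ?N (count_space UNIV)"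
      using i by (intro measurable_compose[OF measurable_snd] measurable_component_singleton)
    have "(\<lambda>\<omega>. fst \<omega> g) \<in> measurable ?N (share_space {1..gen_size g + 1})"
      using g by (intro measurable_compose[OF measurable_fst] measurable_component_singleton) auto
    then have y: "(\<lambda>\<omega>. fst \<omega> g (fwd g)) \<in> measurable ?N (count_space UNIV)"
      by (rule measurable_compose[OF _ measurable_share_eval])
    have "(\<lambda>\<omega>. xor_bits (snd \<omega> i) (fst \<omega> g (fwd g))) \<in> measurable ?N (count_space UNIV)"
      using measurable_compose[OF measurable_count_space_Pair[OF r y],
        of "\<lambda>(a, b). xor_bits a b" "count_space UNIV"] by (simp only: prod.case measurable_count_space_eq1 Pi_UNIV UNIV_I space_count_space)
    with r show "(\<lambda>\<omega>. if i < g then xor_bits (snd \<omega> i) (fst \<omega> g (fwd g)) else snd \<omega> i)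
        \<in> measurable ?N (count_space UNIV)"
      by (cases "i < g") (simp_all only: if_True if_False)
  qed
  \<comment> \<open>The threshold shares form the base and the masks the fibre.\<close>
  have inv: "distr ?Q ?Q (\<lambda>(y, r). (y, shift_masks g y r)) = ?Q"
  proof (rule distr_pair_fibrewise[OF prob_space_masks m])
    show "AE y in PiM {1..} Y. distr (masks L) (masks L) (shift_masks g y) = masks L"
      using len by eventually_elim (rule shift_masks_uniform)
  qed
  have m': "(\<lambda>(y, r). (y, shift_masks g y r)) \<in> measurable ?Q ?Q"
    using measurable_Pair[OF measurable_fst m] by (simp only: split_beta')
  have f: "(\<lambda>(x, p). (x, case p of (y, r) \<Rightarrow> (y, shift_masks g y r))) = (\<lambda>(x, y, r). (x, y, shift_masks g y r))"
    by (simp add: fun_eq_iff)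
  \<comment> \<open>The factor \<open>X\<close> is adjoined with the identity map.\<close>
  have "distr X X (\<lambda>x. x) \<Otimes>\<^sub>M distr ?Q ?Q (\<lambda>(y, r). (y, shift_masks g y r))
      = distr (X \<Otimes>\<^sub>M ?Q) (X \<Otimes>\<^sub>M ?Q) (\<lambda>(x, p). (x, case p of (y, r) \<Rightarrow> (y, shift_masks g y r)))"
    by (rule pair_measure_distr[OF measurable_ident[unfolded id_def] m']) (simp only: inv Q.sigma_finite_measure_axioms)
  then show "distr randomness randomness (\<lambda>(x, y, r). (x, y, shift_masks g y r)) = randomness"
    by (simp only: inv randomness_def distr_id f)
  show "(\<lambda>(x, y, r). (x, y, shift_masks g y r)) \<in> measurable randomness randomness"
    using measurable_Pair[OF measurable_fst measurable_compose[OF measurable_snd m'], of X]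
    by (simp only: randomness_def split_beta' fst_conv snd_conv)
qed

text \<open>The law of the coins when only the shares in \<open>A\<close> and \<open>B i\<close> are
  kept. Secrecy of the ingredients makes it independent of the secret once these sets have at most
  two elements.\<close>

definition marginals where
  "marginals A B = distr X (share_space A) (\<lambda>x. restrict x A) \<Otimes>\<^sub>M
     PiM {1..} (\<lambda>i. distr (Y i) (share_space (B i)) (\<lambda>x. restrict x (B i))) \<Otimes>\<^sub>M masks L"

text \<open>The hypothesis \<open>eq\<close> says that \<open>F\<close> factors through restriction
  to the kept shares. By independence, restriction acts factor by factor, so the restricted coins
  have the product of the marginals as their law.\<close>

lemma distr_marginals:
  fixes F :: "(nat \<Rightarrow> 'a) \<times> (nat \<Rightarrow> nat \<Rightarrow> bool list) \<times> (nat \<Rightarrow> bool list) \<Rightarrow> 'v"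
  assumes A: "A \<subseteq> {1..}" and B: "\<And>i. i \<ge> 1 \<Longrightarrow> B i \<subseteq> {1..gen_size i + 1}"
    and F: "F \<in> measurable (ingredient_space A B) N"
    and eq: "\<And>x y r. F (x, y, r) = F (restrict x A, \<lambda>i\<in>{1..}. restrict (y i) (B i), r)"
  shows "distr randomness N F = distr (marginals A B) N F"
proof -
  let ?K = "\<lambda>(x, y, r). (restrict x A, \<lambda>i\<in>{1::nat..}. restrict (y i) (B i), r)"
  let ?Y = "\<lambda>y. \<lambda>i\<in>{1..}. restrict (y i) (B i)"
  let ?Z = "PiM {1..} (\<lambda>i. share_space (B i))"
  have rX: "(\<lambda>x. restrict x A) \<in> measurable X (share_space A)"
    unfolding measurable_cong_sets[OF sets_X refl] share_space_def by (rule measurable_restrict_subset[OF A])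
  have rYi: "(\<lambda>x. restrict x (B i)) \<in> measurable (Y i) (share_space (B i))" if "i \<in> {1..}" for i
  proof -
    have "i \<ge> 1" using that by simp
    then show ?thesis
      unfolding measurable_cong_sets[OF sets_Y[OF \<open>i \<ge> 1\<close>] refl]
      unfolding share_space_def by (intro measurable_restrict_subset B)
  qed
  have dY: "distr (PiM {1..} Y) ?Z ?Y = PiM {1..} (\<lambda>i. distr (Y i) (share_space (B i)) (\<lambda>x. restrict x (B i)))"
    by (rule distr_PiM_componentwise[OF prob_space_Y rYi]) simp
  have rY: "?Y \<in> measurable (PiM {1..} Y) ?Z"
    by (intro measurable_restrict measurable_compose[OF measurable_component_singleton] rYi)
  interpret R: prob_space "masks L" by (rule prob_space_masks)
  have 1: "PiM {1..} (\<lambda>i. distr (Y i) (share_space (B i)) (\<lambda>x. restrict x (B i))) \<Otimes>\<^sub>M masks L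
      = distr (PiM {1..} Y \<Otimes>\<^sub>M masks L) (?Z \<Otimes>\<^sub>M masks L) (\<lambda>(y, r). (?Y y, r))"
    using pair_measure_distr[OF rY measurable_ident[unfolded id_def], of "masks L"]
    by (simp only: dY R.sigma_finite_measure_axioms distr_id2)
  have m: "(\<lambda>(y, r). (?Y y, r)) \<in> measurable (PiM {1..} Y \<Otimes>\<^sub>M masks L) (?Z \<Otimes>\<^sub>M masks L)"
    using rY by (simp add: split_beta')
  have m': "?K \<in> measurable randomness (share_space A \<Otimes>\<^sub>M ?Z \<Otimes>\<^sub>M masks L)"
    using measurable_Pair[OF measurable_compose[OF measurable_fst rX] measurable_compose[OF measurable_snd m]]
    by (simp only: randomness_def split_beta' fst_conv snd_conv)
  have "marginals A B = distr randomness (share_space A \<Otimes>\<^sub>M ?Z \<Otimes>\<^sub>M masks L)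
      (\<lambda>(x, p). (restrict x A, case p of (y, r) \<Rightarrow> (?Y y, r)))"
    unfolding marginals_def 1 randomness_def
    by (rule pair_measure_distr[OF rX m])
      (intro prob_space_imp_sigma_finite prob_space.prob_space_distr[OF prob_space_Y_masks m])
  then have "distr (marginals A B) N F
      = distr (distr randomness (share_space A \<Otimes>\<^sub>M ?Z \<Otimes>\<^sub>M masks L) ?K) N F"
    by (simp add: split_beta')
  also have "\<dots> = distr randomness N (F \<circ> ?K)"
  proof (rule distr_distr[OF _ m'])
    show "F \<in> measurable (share_space A \<Otimes>\<^sub>M ?Z \<Otimes>\<^sub>M masks L) N"
      using F by (subst measurable_cong_sets[OF _ refl])
        (auto intro!: sets_pair_measure_cong sets_PiM_cong)
  qed
  also have "F \<circ> ?K = F"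
  proof
    show "(F \<circ> ?K) \<omega> = F \<omega>" for \<omega>
      by (cases \<omega>) (simp only: o_apply prod.case, rule eq[symmetric])
  qed
  finally show ?thesis ..
qed

text \<open>After the shift, scheme \<open>g\<close> contributes only the own shares of
  \<open>T\<close>, without its forward share; every other scheme contributes at most its forward
  share.\<close>

lemma distr_view_same_generation:
  assumes T: "T \<subseteq> {1..}" and g: "g \<ge> 1" "\<And>t. t \<in> T \<Longrightarrow> gen_of t = g"
  shows "distr randomness (share_space T) (view T) =
    distr (marginals {g} (\<lambda>i. if i = g then gen_pos ` T else {fwd i})) (share_space T) (unmasked_view g T)"
proof -
  let ?B = "\<lambda>i. if i = g then gen_pos ` T else {fwd i}"
  have "distr randomness (share_space T) (view T)
      = distr randomness (share_space T) (unmasked_view g T \<circ> (\<lambda>(x, y, r). (x, y, shift_masks g y r)))"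
    using g by (intro distr_cong refl) (auto simp: view_eq_unmasked_view_shift_masks)
  also have "\<dots> = distr (distr randomness randomness (\<lambda>(x, y, r). (x, y, shift_masks g y r))) (share_space T) (unmasked_view g T)"
  proof (rule distr_distr[symmetric])
    show "(unmasked_view g T :: 'a coins \<Rightarrow> _) \<in> measurable randomness (share_space T)"
      unfolding measurable_randomness by (rule measurable_unmasked_view[OF g(1)])
    show "(\<lambda>(x, y, r). (x, y, shift_masks g y r)) \<in> measurable randomness randomness"
      by (rule distr_shift_masks(1)[OF g(1)])
  qed
  also have "\<dots> = distr randomness (share_space T) (unmasked_view g T)"
    by (simp only: distr_shift_masks(2)[OF g(1)])
  also have "\<dots> = distr (marginals {g} ?B) (share_space T) (unmasked_view g T)"
  proof (rule distr_marginals)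
    show "?B i \<subseteq> {1..gen_size i + 1}" for i
    proof (cases "i = g")
      case True
      have "gen_pos t \<in> {1..gen_size g + 1}" if "t \<in> T" for t
        using gen_pos_bounds[of t] g(2)[OF that] T that by auto
      with True show ?thesis by auto
    qed (simp add: fwd_def)
    show "(unmasked_view g T :: 'a coins \<Rightarrow> _) \<in> measurable (ingredient_space {g} ?B) (share_space T)"
      by (rule measurable_unmasked_view[OF g(1)])
  qed (use g in \<open>auto simp: unmasked_view_def fun_eq_iff restrict_def\<close>)
  finally show ?thesis .
qed

text \<open>No change of variables: the forward share of each scheme is counted besides the own
  shares. This stays within two shares per scheme when no two members of \<open>T\<close> share a
  generation.\<close>

lemma distr_view:
  assumes T: "T \<subseteq> {1..}"
  shows "distr randomness (share_space T) (view T) =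
    distr (marginals (gen_of ` T) (\<lambda>i. insert (fwd i) (gen_pos ` {t \<in> T. gen_of t = i}))) (share_space T) (view T)"
proof (rule distr_marginals)
  show "gen_of ` T \<subseteq> {1..}"
    using T gen_of_spec by auto
  show "insert (fwd i) (gen_pos ` {t \<in> T. gen_of t = i}) \<subseteq> {1..gen_size i + 1}" for i
  proof -
    have "gen_pos t \<in> {1..gen_size i + 1}" if "t \<in> T" "gen_of t = i" for t
      using gen_pos_bounds[of t] T that by auto
    then show ?thesis by (auto simp: fwd_def)
  qed
  show "(view T :: 'a coins \<Rightarrow> _) \<in> measurable (ingredient_space (gen_of ` T) (\<lambda>i. insert (fwd i) (gen_pos ` {t \<in> T. gen_of t = i}))) (share_space T)"
    by (rule measurable_view[OF T])
  fix x :: "nat \<Rightarrow> 'a" and y r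
  have "gen_of t \<ge> 1" if "t \<in> T" for t
    using that T gen_of_spec by auto
  then show "view T (x, y, r) = view T (restrict x (gen_of ` T),
      \<lambda>i\<in>{1..}. restrict (y i) (insert (fwd i) (gen_pos ` {t \<in> T. gen_of t = i})), r)"
    by (auto simp: view_def revised_share_def fun_eq_iff Let_def)
qed

end

section \<open>Almost sure properties of the coins\<close>

text \<open>As \<open>N\<close> has total mass 1, the first marginal of the product is
  \<open>M\<close>, and null sets pull back along the projection.\<close>

lemma AE_pair_fst:
  assumes "prob_space N" "AE x in M. P x"
  shows "AE z in M \<Otimes>\<^sub>M N. P (fst z)"
proof (rule AE_distrD[OF measurable_fst])
  interpret N: prob_space N by fact
  show "AE x in distr (M \<Otimes>\<^sub>M N) M fst. P x"
    using assms(2) by (simp only: N.distr_pair_fst)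
qed

lemma AE_pair_snd:
  assumes M: "prob_space M" and N: "prob_space N" and P: "AE x in N. P x"
  shows "AE z in M \<Otimes>\<^sub>M N. P (snd z)"
proof -
  interpret M: prob_space M by fact
  interpret N: prob_space N by fact
  interpret pair_prob_space M N ..
  have "AE z in distr (M \<Otimes>\<^sub>M N) (N \<Otimes>\<^sub>M M) (\<lambda>(x, y). (y, x)). P (fst z)"
  proof -
    interpret swap: pair_prob_space N M ..
    show ?thesis
      using AE_pair_fst[OF M P] by (simp only: swap.distr_pair_swap[symmetric])
  qed
  from AE_distrD[OF measurable_pair_swap' this] show ?thesis
    by (simp add: split_beta')
qed

context dealer
begin

lemma AE_randomness_X: "AE x in X. P x \<Longrightarrow> AE (x, y, r) in randomness. P x"
  unfolding randomness_def split_beta' by (rule AE_pair_fst[OF prob_space_Y_masks])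

lemma AE_randomness_Y:
  assumes "i \<ge> 1" "AE z in Y i. P z"
  shows "AE (x, y, r) in randomness. P (y i)"
proof -
  have "AE y in PiM {1..} Y. P (y i)"
    using assms prob_space_Y by (intro AE_PiM_component[where P = P]) auto
  then show ?thesis
    unfolding randomness_def split_beta'
    by (intro AE_pair_snd[OF prob_space_X prob_space_Y_masks, where P = "\<lambda>p. P (fst p i)"]
      AE_pair_fst[OF prob_space_masks, where P = "\<lambda>y. P (y i)"])
qed

lemma AE_randomness_masks:
  assumes "i \<ge> 1"
  shows "AE (x, y, r) in randomness. length (r i) = L"
proof -
  have "AE v in measure_pmf (pmf_of_set (bitstrings L)). length v = L"
    by (simp add: AE_measure_pmf_iff set_pmf_of_set bitstrings_nonempty finite_bitstrings)
      (simp add: bitstrings_def)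
  then have "AE r in masks L. length (r i) = L"
    using assms by (intro AE_PiM_component[where P = "\<lambda>v. length v = L"])
      (auto simp: prob_space_measure_pmf)
  then show ?thesis
    unfolding randomness_def split_beta'
    by (intro AE_pair_snd[OF prob_space_X prob_space_Y_masks, where P = "\<lambda>p. length (snd p i) = L"]
      AE_pair_snd[OF prob_space_PiM_Y prob_space_masks, where P = "\<lambda>r. length (r i) = L"])
qed

lemma measurable_view_randomness:
  "T \<subseteq> {1..} \<Longrightarrow> (view T :: 'a coins \<Rightarrow> _) \<in> measurable randomness (share_space T)"
  unfolding measurable_randomness by (rule measurable_view)

text \<open>\<open>P\<close> will involve an arbitrary reconstruction function, so its measurability
  needs an argument: for finite \<open>T\<close> and countable pieces, \<open>share_space T\<close>
  is discrete. The almost sure statement then passes through the push-forward.\<close>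

lemma AE_view_finite:
  assumes T: "finite T" "T \<subseteq> {1..}" and P: "AE \<omega> in randomness. P (view T \<omega> :: nat \<Rightarrow> 'a piece)"
  shows "AE v in distr randomness (share_space {1..}) (view {1..}). P (restrict v T)"
proof -
  have restr: "(\<lambda>v :: nat \<Rightarrow> 'a piece. restrict v T) \<in> measurable (share_space {1..}) (share_space T)"
    unfolding share_space_def by (rule measurable_restrict_subset[OF T(2)])
  have "share_space T = count_space (T \<rightarrow>\<^sub>E (UNIV :: 'a piece set))"
    unfolding share_space_def by (rule count_space_PiM_finite) (simp_all add: T)
  then have "{v \<in> space (share_space T). P v} \<in> sets (share_space T)"
    by auto
  from measurable_sets[OF restr this]
  have "(\<lambda>v. restrict v T) -` {v \<in> space (share_space T). P v} \<inter> space (share_space {1..}) \<in> sets (share_space {1..})" .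
  also have "(\<lambda>v. restrict v T) -` {v \<in> space (share_space T). P v} \<inter> space (share_space {1..})
      = {v \<in> space (share_space {1..}). P (restrict v T)}"
    using measurable_space[OF restr] by blast
  finally have "(AE v in distr randomness (share_space {1..}) (view {1..}). P (restrict v T))
      \<longleftrightarrow> (AE \<omega> in randomness. P (restrict (view {1..} \<omega>) T))"
    by (intro AE_distr_iff measurable_view_randomness) auto
  moreover have "restrict (view {1..} \<omega>) T = view T \<omega>" for \<omega> :: "'a coins"
    using T(2) by (cases \<omega>) (auto simp: view_def fun_eq_iff)
  ultimately show ?thesis
    using P by simp
qed

end

section \<open>Reconstruction from three views\<close>

text \<open>The lists in a share start at generation 1, whereas list positions start at 0.\<close>

lemma nth_map_upt: "1 \<le> j \<Longrightarrow> j < g \<Longrightarrow> map f [1..<g] ! (j - 1) = f j"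
  by simp

text \<open>The position \<open>u\<close> and the decoder \<open>f\<close> depend only on the
  participants, not on the coins, so \<open>f\<close> can be built into a reconstruction
  function.\<close>

lemma third_share_of_generation:
  fixes a b c :: nat
  assumes "a \<ge> 1" "b \<ge> 1" "c \<ge> 1" "a \<noteq> b" "c \<noteq> a" "c \<noteq> b" "gen_of a = gen_of b"
  obtains u and f :: "(nat \<Rightarrow> 'a piece) \<Rightarrow> bool list"
  where "u \<in> {1..gen_size (gen_of a) + 1}" "u \<noteq> gen_pos a" "u \<noteq> gen_pos b"
    "\<And>T x (y :: nat \<Rightarrow> nat \<Rightarrow> bool list) r. a \<in> T \<Longrightarrow> c \<in> T \<Longrightarrow>
       length (r (gen_of c)) = length (y (gen_of a) (fwd (gen_of a))) \<Longrightarrow>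
       f (view T (x, y, r)) = y (gen_of a) u"
proof -
  let ?g = "gen_of a"
  have g: "?g \<ge> 1" "gen_of c \<ge> 1"
    using gen_of_spec assms by auto
  have pos: "gen_pos a \<in> {1..gen_size ?g}" "gen_pos b \<in> {1..gen_size ?g}"
    using gen_pos_bounds[of a] gen_pos_bounds[of b] assms by auto
  consider "gen_of c = ?g" | "?g < gen_of c" | "gen_of c < ?g"
    by linarith
  then show thesis
  proof cases
    case 1
    show thesis
    \<comment> \<open>The own share of \<open>c\<close>; positions within one generation are
      distinct.\<close>
    proof (rule that[of "gen_pos c" "\<lambda>v. fst (snd (snd (v c)))"])
      show "gen_pos c \<in> {1..gen_size ?g + 1}"
        using gen_pos_bounds[of c] assms 1 by auto
      show "gen_pos c \<noteq> gen_pos a" "gen_pos c \<noteq> gen_pos b"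
        using gen_pos_inj[of c] assms 1 by metis+
    qed (use 1 in \<open>simp add: view_def revised_share_def Let_def\<close>)
  next
    case 2
    show thesis
    \<comment> \<open>The forward share is among those that \<open>c\<close> holds in the
      clear.\<close>
    proof (rule that[of "fwd ?g" "\<lambda>v. fst (snd (v c)) ! (?g - 1)"])
      fix T x and y :: "nat \<Rightarrow> nat \<Rightarrow> bool list" and r :: "nat \<Rightarrow> bool list" assume "c \<in> T"
      then show "fst (snd (view T (x :: nat \<Rightarrow> 'a, y, r) c)) ! (?g - 1) = y ?g (fwd ?g)"
        using 2 g by (simp only: view_def prod.case restrict_apply' revised_share_def Let_def fst_conv snd_conv nth_map_upt)
    qed (use pos in \<open>auto simp: fwd_def\<close>)
  next
    case 3
    show thesis
    \<comment> \<open>Participant \<open>a\<close> holds the forward share under the mask of the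
      generation of \<open>c\<close>, and \<open>c\<close> holds that mask.\<close>
    proof (rule that[of "fwd ?g" "\<lambda>v. xor_bits (fst (snd (snd (snd (v a)))) ! (gen_of c - 1)) (snd (snd (snd (snd (v c)))))"])
      fix T x and y :: "nat \<Rightarrow> nat \<Rightarrow> bool list" and r :: "nat \<Rightarrow> bool list"
      assume "a \<in> T" "c \<in> T" "length (r (gen_of c)) = length (y ?g (fwd ?g))"
      then show "xor_bits (fst (snd (snd (snd (view T (x :: nat \<Rightarrow> 'a, y, r) a)))) ! (gen_of c - 1))
          (snd (snd (snd (snd (view T (x, y, r) c))))) = y ?g (fwd ?g)"
        using 3 g by (simp only: view_def prod.case restrict_apply' revised_share_def Let_def fst_conv snd_conv nth_map_upt xor_bits_cancel)
    qed (use pos in \<open>auto simp: fwd_def\<close>)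
  qed
qed

text \<open>This assembles, from the view alone, the argument expected by the reconstruction
  function of the threshold scheme.\<close>

lemma restrict_three_shares:
  assumes "gen_of b = gen_of a" "u \<noteq> gen_pos a" "u \<noteq> gen_pos b" "a \<in> T" "b \<in> T" "w = y (gen_of a) u"
  shows "(\<lambda>i\<in>{gen_pos a, gen_pos b, u}. if i = gen_pos a then fst (snd (snd (view T (x, y, r) a)))
      else if i = gen_pos b then fst (snd (snd (view T (x, y, r) b))) else w)
    = restrict (y (gen_of a)) {gen_pos a, gen_pos b, u}"
  using assms by (auto simp: fun_eq_iff view_def revised_share_def Let_def)

text \<open>All members of a generation hold the same evolving share, so one representative, picked
  by \<open>inv_into\<close>, is enough.\<close>

lemma restrict_generation_shares:
  "(\<lambda>i\<in>gen_of ` T. fst (view T (x, y, r) (inv_into T gen_of i))) = restrict x (gen_of ` T)"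
proof
  fix i
  show "(\<lambda>i\<in>gen_of ` T. fst (view T (x, y, r) (inv_into T gen_of i))) i = restrict x (gen_of ` T) i"
    using inv_into_into[of i gen_of T] f_inv_into_f[of i gen_of T]
    by (simp add: view_def revised_share_def Let_def restrict_def)
qed

section \<open>The revised scheme\<close>

lemma sharing_schemeD:
  assumes "sharing_scheme I S D" "s \<in> S"
  shows "prob_space (D s)" "sets (D s) = sets (share_space I)"
  using assms by (simp_all add: sharing_scheme_def)

lemma perfectly_correctD:
  assumes "perfectly_correct k I S D" "C \<subseteq> I" "k \<le> card C"
  shows "\<exists>rec. \<forall>s\<in>S. AE x in D s. rec (restrict x C) = s"
  using assms by (simp add: perfectly_correct_def)

lemma perfectly_secretD:
  assumes "perfectly_secret k I S D" "C \<subseteq> I" "finite C" "card C < k" "s \<in> S" "s' \<in> S"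
  shows "distr (D s) (share_space C) (\<lambda>x. restrict x C) = distr (D s') (share_space C) (\<lambda>x. restrict x C)"
  using assms(1)[unfolded perfectly_secret_def, rule_format, OF assms(2) conjI[OF assms(3,4)] assms(5,6)] .

theorem mainTheorem2:
  fixes l L :: nat
    and Dinf :: "bool list \<Rightarrow> (nat \<Rightarrow> 'a::countable) measure"
    and D :: "nat \<Rightarrow> bool list \<Rightarrow> (nat \<Rightarrow> bool list) measure"
  assumes "l \<ge> 1"
    and "evolving_threshold_scheme 3 (bitstrings l) Dinf"
    and "\<And>i. i \<ge> 1 \<Longrightarrow> threshold_scheme 3 (gen_size i + 1) (bitstrings l) (D i)"
    and "\<And>i s. i \<ge> 1 \<Longrightarrow> s \<in> bitstrings l \<Longrightarrow> AE y in D i s. length (y (fwd i)) = L"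
  shows "evolving_threshold_scheme 3 (bitstrings l) (revised_scheme L Dinf D)"
proof -
  let ?S = "bitstrings l"
  have inf: "sharing_scheme {1..} ?S Dinf" "perfectly_correct 3 {1..} ?S Dinf" "perfectly_secret 3 {1..} ?S Dinf"
    using assms(2) by (simp_all only: evolving_threshold_scheme_def)
  have thr: "sharing_scheme {1..gen_size i + 1} ?S (D i)" "perfectly_correct 3 {1..gen_size i + 1} ?S (D i)"
    "perfectly_secret 3 {1..gen_size i + 1} ?S (D i)" if "i \<ge> 1" for i
    using assms(3)[OF that] by (simp_all only: threshold_scheme_def)
  have dealer: "dealer L (Dinf s) (\<lambda>i. D i s)" if "s \<in> ?S" for s
    by (rule dealer.intro)
      (use that in \<open>simp_all only: sharing_schemeD[OF inf(1)] sharing_schemeD[OF thr(1)] assms(4)\<close>)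
  have scheme: "revised_scheme L Dinf D s =
      distr (dealer.randomness L (Dinf s) (\<lambda>i. D i s)) (share_space {1..}) (view {1..})"
    if "s \<in> ?S" for s
    by (simp only: revised_scheme_def dealer.randomness_def[OF dealer[OF that]] view_def)

  have "sharing_scheme {1..} ?S (revised_scheme L Dinf D)"
    unfolding sharing_scheme_def
  proof (intro ballI conjI)
    fix s assume s: "s \<in> ?S"
    interpret dealer L "Dinf s" "\<lambda>i. D i s" by (rule dealer[OF s])
    show "prob_space (revised_scheme L Dinf D s)"
      unfolding scheme[OF s]
      by (rule prob_space.prob_space_distr[OF prob_space_randomness measurable_view_randomness]) simp
    show "sets (revised_scheme L Dinf D s) = sets (share_space {1..})"
      unfolding scheme[OF s] by (rule sets_distr)
  qed

  \<comment> \<open>Correctness\<close>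
  moreover have "perfectly_correct 3 {1..} ?S (revised_scheme L Dinf D)"
    unfolding perfectly_correct_def
  proof (intro allI impI)
    fix C :: "nat set" assume C: "C \<subseteq> {1..}" "infinite C \<or> 3 \<le> card C"
    \<comment> \<open>Three participants suffice even for infinite \<open>C\<close>, and a finite
      \<open>T\<close> is what \<open>AE_view_finite\<close> requires.\<close>
    then obtain T where T: "T \<subseteq> C" "finite T" "card T = 3"
      using infinite_arbitrarily_large[of C 3] obtain_subset_with_card_n[of 3 C] by metis
    have T1: "T \<subseteq> {1..}"
      using T C by blast
    \<comment> \<open>One function must serve all secrets. It is found on the coins first and
      carried over to the share distribution afterwards.\<close>
    have "\<exists>rec :: (nat \<Rightarrow> 'a piece) \<Rightarrow> bool list. \<forall>s\<in>?S.
        AE \<omega> in dealer.randomness L (Dinf s) (\<lambda>i. D i s). rec (view T \<omega>) = s"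
    proof (cases "inj_on gen_of T")
      case True
      then have "gen_of ` T \<subseteq> {1..}" "3 \<le> card (gen_of ` T)"
        using T T1 gen_of_spec by (auto simp: card_image)
      then obtain rec where rec: "\<forall>s\<in>?S. AE x in Dinf s. rec (restrict x (gen_of ` T)) = s"
        using perfectly_correctD[OF inf(2)] by blast
      show ?thesis
      proof (intro exI ballI)
        fix s assume s: "s \<in> ?S"
        interpret dealer L "Dinf s" "\<lambda>i. D i s" by (rule dealer[OF s])
        have "AE (x, y, r) in randomness. rec (restrict x (gen_of ` T)) = s"
          using rec s by (intro AE_randomness_X) blast
        then show "AE \<omega> in randomness. rec (\<lambda>i\<in>gen_of ` T. fst (view T \<omega> (inv_into T gen_of i))) = s"
        proof eventually_elim
          case (elim \<omega>)
          then show ?case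
            by (cases \<omega>) (simp only: prod.case restrict_generation_shares)
        qed
      qed
    next
      case False
      then obtain a b where ab: "a \<in> T" "b \<in> T" "a \<noteq> b" "gen_of a = gen_of b"
        by (auto simp: inj_on_def)
      have "card {a, b} < card T"
        using ab T by simp
      then obtain c where c: "c \<in> T" "c \<noteq> a" "c \<noteq> b"
        using card_mono[of "{a, b}" T] by fastforce
      have ge1: "a \<ge> 1" "b \<ge> 1" "c \<ge> 1"
        using ab c T1 by auto
      let ?g = "gen_of a"
      have g: "?g \<ge> 1" "gen_of c \<ge> 1"
        using ge1 gen_of_spec by auto
      obtain u and f :: "(nat \<Rightarrow> 'a piece) \<Rightarrow> bool list"
        where u: "u \<in> {1..gen_size ?g + 1}" "u \<noteq> gen_pos a" "u \<noteq> gen_pos b"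
          and f: "\<And>T x (y :: nat \<Rightarrow> nat \<Rightarrow> bool list) r. a \<in> T \<Longrightarrow> c \<in> T \<Longrightarrow> length (r (gen_of c)) = length (y ?g (fwd ?g)) \<Longrightarrow>
            f (view T (x, y, r)) = y ?g u"
        using third_share_of_generation[OF ge1 ab(3) c(2,3) ab(4)] by metis
      let ?J = "{gen_pos a, gen_pos b, u}"
      have "gen_pos a \<noteq> gen_pos b"
        using gen_pos_inj ge1 ab by blast
      then have "3 \<le> card ?J"
        using u by simp
      moreover have "?J \<subseteq> {1..gen_size ?g + 1}"
        using u gen_pos_bounds[of a] gen_pos_bounds[of b] ge1 ab by auto
      ultimately obtain rec where rec: "\<forall>s\<in>?S. AE y in D ?g s. rec (restrict y ?J) = s"
        using perfectly_correctD[OF thr(2)[OF g(1)]] by blast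
      let ?piece = "\<lambda>v t. fst (snd (snd (v t)))"
      show ?thesis
      proof (intro exI ballI)
        fix s assume s: "s \<in> ?S"
        interpret dealer L "Dinf s" "\<lambda>i. D i s" by (rule dealer[OF s])
        have "AE (x, y, r) in randomness. rec (restrict (y ?g) ?J) = s"
          using rec s by (intro AE_randomness_Y[OF g(1), where P = "\<lambda>y. rec (restrict y ?J) = s"]) blast
        moreover have "AE (x, y, r) in randomness. length (y ?g (fwd ?g)) = L"
          by (rule AE_randomness_Y[OF g(1) length_fwd[OF g(1)]])
        \<comment> \<open>The own shares of \<open>a\<close> and \<open>b\<close> and the decoded
          third share are fed to the threshold scheme of generation \<open>?g\<close>.\<close>
        ultimately show "AE \<omega> in randomness. (\<lambda>v. rec (\<lambda>i\<in>?J. if i = gen_pos a then ?piece v a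
            else if i = gen_pos b then ?piece v b else f v)) (view T \<omega>) = s"
          using AE_randomness_masks[OF g(2)]
        proof eventually_elim
          case (elim \<omega>)
          obtain x y r where \<omega>: "\<omega> = (x, y, r)"
            by (cases \<omega>)
          have "f (view T (x, y, r)) = y ?g u"
            using elim by (intro f ab c) (simp add: \<omega>)
          note restrict_three_shares[where y = y and x = x and r = r, OF ab(4)[symmetric] u(2,3) ab(1,2) this]
          with elim(1) show ?case
            by (simp only: \<omega> prod.case)
        qed
      qed
    qed
    then obtain rec :: "(nat \<Rightarrow> 'a piece) \<Rightarrow> bool list" where
      rec: "\<forall>s\<in>?S. AE \<omega> in dealer.randomness L (Dinf s) (\<lambda>i. D i s). rec (view T \<omega>) = s" ..
    show "\<exists>rec :: (nat \<Rightarrow> 'a piece) \<Rightarrow> bool list. \<forall>s\<in>?S.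
        AE x in revised_scheme L Dinf D s. rec (restrict x C) = s"
    proof (intro exI ballI)
      fix s assume s: "s \<in> ?S"
      have "AE v in revised_scheme L Dinf D s. rec (restrict v T) = s"
        unfolding scheme[OF s]
        by (rule dealer.AE_view_finite[OF dealer[OF s] T(2) T1]) (use rec s in blast)
      moreover have "restrict (restrict v C) T = restrict v T" for v :: "nat \<Rightarrow> 'a piece"
        using T(1) by (simp add: Int_absorb1)
      ultimately show "AE x in revised_scheme L Dinf D s. (\<lambda>v. rec (restrict v T)) (restrict x C) = s"
        by simp
    qed
  qed

  \<comment> \<open>Secrecy\<close>
  moreover have "perfectly_secret 3 {1..} ?S (revised_scheme L Dinf D)"
    unfolding perfectly_secret_def
  proof (intro allI impI ballI)
    fix C :: "nat set" and s s' :: "bool list"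
    assume C: "C \<subseteq> {1..}" "finite C \<and> card C < 3" and s: "s \<in> ?S" "s' \<in> ?S"
    let ?R = "\<lambda>s. dealer.randomness L (Dinf s) (\<lambda>i. D i s)"
    let ?M = "\<lambda>s. dealer.marginals L (Dinf s) (\<lambda>i. D i s)"
    have view: "distr (revised_scheme L Dinf D s) (share_space C) (\<lambda>x. restrict x C)
        = distr (?R s) (share_space C) (view C)" if s: "s \<in> ?S" for s
    proof -
      have "distr (revised_scheme L Dinf D s) (share_space C) (\<lambda>x. restrict x C)
          = distr (?R s) (share_space C) ((\<lambda>x. restrict x C) \<circ> view {1..})"
        unfolding scheme[OF s]
        by (rule distr_distr[OF _ dealer.measurable_view_randomness[OF dealer[OF s]]])
          (simp_all only: share_space_def measurable_restrict_subset[OF C(1)] subset_refl)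
      also have "(\<lambda>x. restrict x C) \<circ> view {1..} = (view C :: 'a coins \<Rightarrow> _)"
        using C(1) by (auto simp: view_def fun_eq_iff)
      finally show ?thesis .
    qed
    \<comment> \<open>With at most two shares kept per ingredient, each factor is the same for both
      secrets, hence so is the product.\<close>
    have marginals: "?M s A B = ?M s' A B"
      if A: "A \<subseteq> {1..}" "finite A" "card A < 3"
        and B: "\<And>i. i \<ge> 1 \<Longrightarrow> B i \<subseteq> {1..gen_size i + 1} \<and> card (B i) < 3" for A B
    proof -
      have "distr (Dinf s) (share_space A) (\<lambda>x. restrict x A) = distr (Dinf s') (share_space A) (\<lambda>x. restrict x A)"
        by (rule perfectly_secretD[OF inf(3) A s])
      moreover have "PiM {1..} (\<lambda>i. distr (D i s) (share_space (B i)) (\<lambda>x. restrict x (B i)))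
          = PiM {1..} (\<lambda>i. distr (D i s') (share_space (B i)) (\<lambda>x. restrict x (B i)))"
      proof (rule PiM_cong)
        fix i :: nat assume "i \<in> {1..}"
        then have i: "i \<ge> 1" by simp
        then have "finite (B i)"
          using B[OF i] finite_subset by blast
        with B[OF i] s show "distr (D i s) (share_space (B i)) (\<lambda>x. restrict x (B i))
            = distr (D i s') (share_space (B i)) (\<lambda>x. restrict x (B i))"
          by (intro perfectly_secretD[OF thr(3)[OF i]]) simp_all
      qed simp
      ultimately show ?thesis
        by (simp only: dealer.marginals_def[OF dealer] s)
    qed
    have pos: "gen_pos t \<in> {1..gen_size (gen_of t) + 1}" "gen_of t \<ge> 1" if "t \<in> C" for t
      using that C(1) gen_pos_bounds[of t] gen_of_spec[of t] by auto
    have "distr (?R s) (share_space C) (view C) = distr (?R s') (share_space C) (view C)"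
    \<comment> \<open>The first case includes the empty set and single participants.\<close>
    proof (cases "\<exists>g\<ge>1. \<forall>t\<in>C. gen_of t = g")
      case True
      then obtain g where g: "g \<ge> 1" "\<And>t. t \<in> C \<Longrightarrow> gen_of t = g"
        by blast
      let ?B = "\<lambda>i. if i = g then gen_pos ` C else {fwd i}"
      have "?B i \<subseteq> {1..gen_size i + 1} \<and> card (?B i) < 3" for i
        using pos g C(2) card_image_le[of C gen_pos] by (auto simp: fwd_def image_subset_iff)
      then have "?M s {g} ?B = ?M s' {g} ?B"
        using g(1) by (intro marginals) auto
      then show ?thesis
        by (simp only: dealer.distr_view_same_generation[OF dealer C(1) g] s)
    next
      case False
      let ?B = "\<lambda>i. insert (fwd i) (gen_pos ` {t \<in> C. gen_of t = i})"
      have "?B i \<subseteq> {1..gen_size i + 1} \<and> card (?B i) < 3" if i: "i \<ge> 1" for i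
      proof
        show "?B i \<subseteq> {1..gen_size i + 1}"
          using pos by (auto simp: fwd_def)
        \<comment> \<open>No generation contains all of \<open>C\<close>, so each has at most one of
          its members; with the forward share this gives at most two shares per scheme.\<close>
        have "{t \<in> C. gen_of t = i} \<subset> C"
          using False i by blast
        then have "card {t \<in> C. gen_of t = i} < card C"
          using C(2) by (intro psubset_card_mono) auto
        then have "card (gen_pos ` {t \<in> C. gen_of t = i}) < 2"
          using C(2) card_image_le[of "{t \<in> C. gen_of t = i}" gen_pos] by simp
        then show "card (?B i) < 3"
          using card_insert_le_m1[of 2 "gen_pos ` {t \<in> C. gen_of t = i}" "fwd i"]
          by (simp add: card_insert_if C(2))
      qed
      moreover have "gen_of ` C \<subseteq> {1..}" "card (gen_of ` C) < 3"
        using pos C(2) card_image_le[of C gen_of] by auto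
      ultimately have "?M s (gen_of ` C) ?B = ?M s' (gen_of ` C) ?B"
        using C(2) by (intro marginals) auto
      then show ?thesis
        by (simp only: dealer.distr_view[OF dealer C(1)] s)
    qed
    then show "distr (revised_scheme L Dinf D s) (share_space C) (\<lambda>x. restrict x C) =
        distr (revised_scheme L Dinf D s') (share_space C) (\<lambda>x. restrict x C)"
      by (simp only: view s)
  qed

  ultimately show ?thesis
    by (simp add: evolving_threshold_scheme_def)
qed

end
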